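(* Let $\mathbf{pd}$ be the period-doubling word, $P_{\mathbf{pd}}(n)=\sum_{i=0}^{n-1}p_{\mathbf{pd}}(i)$ and $h_{\mathbf{pd}}(n)=P_{\mathbf{pd}}(n)/n$. Then for every integer $n\ge 1$, \[ \Big(\tfrac13\log_2 n-\tfrac1{18}\Big)n+\tfrac49 \le P_{\mathbf{pd}}(n)\le \Big(\tfrac43\log_2 n+\tfrac{22}{9}\Big)n+\tfrac59\] and \[ \tfrac13\log_2 n-\tfrac1{18}\le h_{\mathbf{pd}}(n)\le \tfrac43\log_2 n+3.\]
   Context: The period-doubling word $\mathbf{pd}=w_0w_1w_2\cdots$ is the infinite fixed point (starting with $0$) of the morphism $0\mapsto 01$, $1\mapsto 00$. For an infinite word $\mathbf w=w_0w_1w_2\cdots$, the periodicity function $p_{\mathbf w}(i)$ is the length of the shortest nonempty prefix $u$ of $w_iw_{i+1}w_{i+2}\cdots$ such that either $u$ is a suffix of $w_0\cdots w_{i-1}$ or $w_0\cdots w_{i-1}$ is a suffix of $u$ (for $i=0$, $w_0\cdots w_{i-1}$ is the empty word); if no such $u$ exists, $p_{\mathbf w}(i)=\infty$ (this does not occur for recurrent words such as $\mathbf{pd}$). *)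

theory Defs
  imports
    Complex_Main
    "HOL-Library.Sublist"
    "HOL-Library.Omega_Words_Fun"
    "HOL-Library.Extended_Real"
    "HOL-Library.Z2"
begin

text \<open>
  Infinite words are functions on the natural numbers
  (\<^typ>\<open>'a word\<close> from \<open>Omega_Words_Fun\<close>), finite words are lists. Both
  \<open>Sublist\<close> and \<open>Omega_Words_Fun\<close> provide \<open>prefix\<close> and \<open>suffix\<close>, so these
  names are qualified throughout.
\<close>

definition apply_morphism :: "('a \<Rightarrow> 'b list) \<Rightarrow> 'a list \<Rightarrow> 'b list" where
  "apply_morphism \<phi> u = concat (map \<phi> u)"

text \<open>
  A morphism fixes an infinite word \<open>w\<close> iff the image of every finite prefix of \<open>w\<close> is again
  a prefix of \<open>w\<close>. This expresses \<open>\<phi>(w) = w\<close> for every morphism under which no letter has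
  an empty image.
\<close>

definition is_fixed_point :: "('a \<Rightarrow> 'a list) \<Rightarrow> 'a word \<Rightarrow> bool" where
  "is_fixed_point \<phi> w \<longleftrightarrow>
     (\<forall>k. let v = apply_morphism \<phi> (Omega_Words_Fun.prefix k w)
          in v = Omega_Words_Fun.prefix (length v) w)"

definition pd_morphism :: "bit \<Rightarrow> bit list" where
  "pd_morphism a = (if a = 0 then [0, 1] else [0, 0])"

text \<open>Well-defined by lemma \<open>pd_ex1\<close> below.\<close>

definition pd :: "bit word" where
  "pd = (THE w. is_fixed_point pd_morphism w \<and> w 0 = 0)"

text \<open>The infimum of the empty set of type \<^typ>\<open>enat\<close> is \<open>\<infinity>\<close>.\<close>

definition periodicity :: "'a word \<Rightarrow> nat \<Rightarrow> enat" where
  "periodicity w i =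
     Inf {enat (length u) | u.
            u \<noteq> [] \<and>
            u = Omega_Words_Fun.prefix (length u) (Omega_Words_Fun.suffix i w) \<and>
            (Sublist.suffix u (Omega_Words_Fun.prefix i w) \<or>
             Sublist.suffix (Omega_Words_Fun.prefix i w) u)}"

definition sum_periodicity :: "'a word \<Rightarrow> nat \<Rightarrow> enat" where
  "sum_periodicity w n = (\<Sum>i<n. periodicity w i)"

definition mean_periodicity :: "'a word \<Rightarrow> nat \<Rightarrow> ereal" where
  "mean_periodicity w n = ereal_of_enat (sum_periodicity w n) / ereal (real n)"

lemma length_apply_pd_morphism [simp]: "length (apply_morphism pd_morphism u) = 2 * length u"
  by (induction u) (simp_all add: apply_morphism_def pd_morphism_def)

lemma is_fixed_point_pd_morphism_iff:
  "is_fixed_point pd_morphism w \<longleftrightarrow> (\<forall>n. w (2 * n) = 0 \<and> w (2 * n + 1) = w n + 1)"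
proof -
  have step: "[w (2 * n), w (2 * n + 1)] = pd_morphism (w n) \<longleftrightarrow>
      w (2 * n) = 0 \<and> w (2 * n + 1) = w n + 1" for n
    by (cases "w n") (auto simp: pd_morphism_def)
  have image_Suc: "apply_morphism pd_morphism (Omega_Words_Fun.prefix (Suc k) w) =
      apply_morphism pd_morphism (Omega_Words_Fun.prefix k w) @ pd_morphism (w k)" for k
    by (simp add: apply_morphism_def subsequence_def)
  have prefix_Suc: "Omega_Words_Fun.prefix (2 * Suc k) w =
      Omega_Words_Fun.prefix (2 * k) w @ [w (2 * k), w (2 * k + 1)]" for k
    by (simp add: subsequence_def)
  have "is_fixed_point pd_morphism w \<longleftrightarrow>
      (\<forall>k. apply_morphism pd_morphism (Omega_Words_Fun.prefix k w) =
           Omega_Words_Fun.prefix (2 * k) w)" (is "_ \<longleftrightarrow> (\<forall>k. ?A k)")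
    by (simp add: is_fixed_point_def Let_def)
  also have "\<dots> \<longleftrightarrow> (\<forall>n. [w (2 * n), w (2 * n + 1)] = pd_morphism (w n))"
  proof
    assume A: "\<forall>k. ?A k"
    show "\<forall>n. [w (2 * n), w (2 * n + 1)] = pd_morphism (w n)"
    proof
      fix n
      from A have "?A n" and "?A (Suc n)" by blast+
      then show "[w (2 * n), w (2 * n + 1)] = pd_morphism (w n)"
        unfolding image_Suc prefix_Suc by simp
    qed
  next
    assume B: "\<forall>n. [w (2 * n), w (2 * n + 1)] = pd_morphism (w n)"
    show "\<forall>k. ?A k"
    proof
      fix k show "?A k"
      proof (induction k)
        case 0
        then show ?case by (simp add: apply_morphism_def subsequence_def)
      next
        case (Suc k)
        then show ?case unfolding image_Suc prefix_Suc using B by simp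
      qed
    qed
  qed
  finally show ?thesis unfolding step .
qed

function pd_rec :: "nat \<Rightarrow> bit" where
  "pd_rec n = (if even n then 0 else pd_rec (n div 2) + 1)"
  by auto
termination by (relation "measure id") (auto elim: oddE)

declare pd_rec.simps [simp del]

lemma pd_ex1: "\<exists>!w. is_fixed_point pd_morphism w \<and> w 0 = 0"
proof
  have rec: "pd_rec (2 * n) = 0" "pd_rec (2 * n + 1) = pd_rec n + 1" for n
    by (subst pd_rec.simps, simp)+
  then show "is_fixed_point pd_morphism pd_rec \<and> pd_rec 0 = 0"
    unfolding is_fixed_point_pd_morphism_iff by (metis mult_0_right)
  fix w assume w: "is_fixed_point pd_morphism w \<and> w 0 = 0"
  show "w = pd_rec"
  proof
    fix n show "w n = pd_rec n"
    proof (induction n rule: less_induct)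
      case (less n)
      show ?case
      proof (cases "even n")
        case True
        then show ?thesis using w rec(1) by (metis is_fixed_point_pd_morphism_iff evenE)
      next
        case False
        then obtain m where m: "n = 2 * m + 1" by (elim oddE)
        have "w n = w m + 1" using w m by (simp add: is_fixed_point_pd_morphism_iff)
        also have "w m = pd_rec m" using m by (intro less.IH) simp
        finally show ?thesis using rec(2)[of m] m by simp
      qed
    qed
  qed
qed

lemma pd_fixed_point: "is_fixed_point pd_morphism pd" and pd_0: "pd 0 = 0"
  using theI'[OF pd_ex1] by (simp_all add: pd_def)

end

theory Submission
  imports Defs
begin

text \<open>
  Since \<open>pd (2 * n) = 0\<close> and \<open>pd (2 * n + 1) = pd n + 1\<close>, a repetition of even length \<open>2 * l\<close>
  centred at \<open>2 * i\<close> or at \<open>2 * i + 1\<close> is the image of a repetition of length \<open>l\<close> centred at \<open>i\<close>,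
  whereas \<open>1\<close> is the only relevant odd length. Writing \<open>p\<close> for the periodicity function, this gives
  \<open>p (2 * i) + p (2 * i + 1) = 2 * p i + 1 + [i > 0 \<and> p i = 1]\<close>, hence
  \<open>2 * P n + n \<le> P (2 * n) \<le> 2 * P n + 3 / 2 * n\<close> for the partial sums \<open>P\<close>, because
  \<open>p i = 1\<close> with \<open>i > 0\<close> forces \<open>i \<equiv> 0, 3 (mod 4)\<close>. Both bounds follow by
  induction on the binary length \<open>k\<close> of \<open>n\<close>, with the logarithm replaced by \<open>k + 1\<close>
  and \<open>k\<close>, respectively.
\<close>

section \<open>Repetitions centred at a position of an arbitrary word\<close>

text \<open>Only pairs with both letters inside the two words meeting at \<open>i\<close> are
  compared, so one formula covers a \<open>u\<close> shorter or longer than the prefix. Writing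
  \<open>i \<le> j + l\<close> avoids truncated subtraction.\<close>

definition repetition :: "'a word \<Rightarrow> nat \<Rightarrow> nat \<Rightarrow> bool" where
  "repetition w i l \<longleftrightarrow> 0 < l \<and> (\<forall>j<i. i \<le> j + l \<longrightarrow> w j = w (j + l))"

lemma suffix_iff_nth:
  assumes "length u \<le> length v"
  shows "Sublist.suffix u v \<longleftrightarrow> (\<forall>j<length u. u ! j = v ! (length v - length u + j))"
proof -
  have "Sublist.suffix u v \<longleftrightarrow> u = drop (length v - length u) v"
  proof
    assume "u = drop (length v - length u) v"
    then show "Sublist.suffix u v" by (metis suffix_drop)
  qed (auto simp: Sublist.suffix_def)
  then show ?thesis
    using assms by (auto simp: list_eq_iff_nth_eq)
qed

text \<open>Comparing lengths ties the two alternatives to \<open>l \<le> i\<close> and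
  \<open>i \<le> l\<close>; in both cases aligning the right ends pairs \<open>j\<close> with
  \<open>j + l\<close>.\<close>

lemma repetition_iff_suffix:
  fixes w :: "'a word"
  defines "u i l \<equiv> Omega_Words_Fun.prefix l (Omega_Words_Fun.suffix i w)"
  shows "repetition w i l \<longleftrightarrow> u i l \<noteq> [] \<and>
    (Sublist.suffix (u i l) (Omega_Words_Fun.prefix i w) \<or>
     Sublist.suffix (Omega_Words_Fun.prefix i w) (u i l))"
proof -
  have len: "length (u i l) = l" and nth: "\<And>j. j < l \<Longrightarrow> u i l ! j = w (i + j)"
    by (simp_all add: u_def)
  have ne: "u i l \<noteq> [] \<longleftrightarrow> 0 < l"
    using len by (metis length_greater_0_conv)
  have le: "Sublist.suffix (u i l) (Omega_Words_Fun.prefix i w) \<longleftrightarrow>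
      (\<forall>j<i. i \<le> j + l \<longrightarrow> w j = w (j + l))" if "l \<le> i"
  proof -
    have "Sublist.suffix (u i l) (Omega_Words_Fun.prefix i w) \<longleftrightarrow>
        (\<forall>j<l. w (i + j) = w (i - l + j))"
      using that by (subst suffix_iff_nth) (auto simp: len nth)
    also have "\<dots> \<longleftrightarrow> (\<forall>j<i. i \<le> j + l \<longrightarrow> w j = w (j + l))" (is "?A \<longleftrightarrow> ?B")
    proof
      assume A: ?A
      show ?B
      proof (intro allI impI)
        fix j assume "j < i" "i \<le> j + l"
        \<comment> \<open>The pair \<open>j\<close>, \<open>j + l\<close> is compared at offset
          \<open>j + l - i\<close> of \<open>u i l\<close>.\<close>
        then have "j + l - i < l" "i + (j + l - i) = j + l" "i - l + (j + l - i) = j"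
          using that by auto
        with A show "w j = w (j + l)" by metis
      qed
    next
      assume B: ?B
      show ?A
      proof (intro allI impI)
        fix j assume "j < l"
        then show "w (i + j) = w (i - l + j)"
          using B[rule_format, of "i - l + j"] that by (simp add: add.commute)
      qed
    qed
    finally show ?thesis .
  qed
  have ge: "Sublist.suffix (Omega_Words_Fun.prefix i w) (u i l) \<longleftrightarrow>
      (\<forall>j<i. i \<le> j + l \<longrightarrow> w j = w (j + l))" if "i \<le> l"
    using that by (subst suffix_iff_nth) (auto simp: len nth add.commute)
  have "Sublist.suffix (u i l) (Omega_Words_Fun.prefix i w) \<Longrightarrow> l \<le> i"
    using len by (metis suffix_length_le subsequence_length diff_zero)
  moreover have "Sublist.suffix (Omega_Words_Fun.prefix i w) (u i l) \<Longrightarrow> i \<le> l"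
    using len by (metis suffix_length_le subsequence_length diff_zero)
  ultimately show ?thesis
    using le ge ne unfolding repetition_def by (meson nat_le_linear)
qed

text \<open>The hypothesis excludes the empty set, whose infimum is \<open>\<infinity>\<close> while
  \<open>LEAST\<close> is unspecified.\<close>

lemma periodicity_eq_Least:
  assumes "repetition w i l"
  shows "periodicity w i = enat (LEAST l. repetition w i l)"
proof -
  have "{enat (length u) | u. u \<noteq> [] \<and>
            u = Omega_Words_Fun.prefix (length u) (Omega_Words_Fun.suffix i w) \<and>
            (Sublist.suffix u (Omega_Words_Fun.prefix i w) \<or>
             Sublist.suffix (Omega_Words_Fun.prefix i w) u)} = enat ` {l. repetition w i l}"
    (is "?A = ?B")
  proof
    show "?A \<subseteq> ?B"
      by (auto simp: repetition_iff_suffix)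
    show "?B \<subseteq> ?A"
    proof
      fix x assume "x \<in> ?B"
      then obtain l where l: "x = enat l" "repetition w i l" by auto
      let ?u = "Omega_Words_Fun.prefix l (Omega_Words_Fun.suffix i w)"
      have "length ?u = l" by simp
      then show "x \<in> ?A"
        using l unfolding repetition_iff_suffix by (intro CollectI exI[of _ ?u]) auto
    qed
  qed
  then have "periodicity w i = Inf (enat ` {l. repetition w i l})"
    by (simp add: periodicity_def)
  also have "\<dots> = enat (LEAST l. repetition w i l)"
    by (rule Inf_eqI) (auto intro: Least_le LeastI[of "repetition w i", OF assms])
  finally show ?thesis .
qed

section \<open>Repetitions in the period-doubling word\<close>

lemma pd_even [simp]: "pd (2 * n) = 0"
  and pd_odd [simp]: "pd (Suc (2 * n)) = pd n + 1"
  using pd_fixed_point by (simp_all add: is_fixed_point_pd_morphism_iff)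

lemma pd_mod_4_eq_1: "n mod 4 = 1 \<Longrightarrow> pd n = 1"
proof -
  assume "n mod 4 = 1"
  then have "n = Suc (2 * (2 * (n div 4)))"
    by presburger
  then show ?thesis
    by (metis pd_even pd_odd add_0)
qed

lemma repetition_one: "repetition w (Suc i) 1 \<longleftrightarrow> w i = w (Suc i)"
  unfolding repetition_def by (auto simp: less_Suc_eq)

text \<open>An even shift preserves parity. Even positions all carry \<open>0\<close> and impose
  nothing; at either centre the odd positions compared are \<open>Suc (2 * m)\<close> with
  \<open>m < i\<close> and \<open>i \<le> m + l\<close>, and adding \<open>1\<close> to both letters
  preserves equality.\<close>

lemma repetition_pd_double: "repetition pd (2 * i) (2 * l) \<longleftrightarrow> repetition pd i l" (is ?even)
  and repetition_pd_double_Suc: "repetition pd (Suc (2 * i)) (2 * l) \<longleftrightarrow> repetition pd i l" (is ?odd)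
proof -
  have even: "(\<forall>j<2 * i. 2 * i \<le> j + 2 * l \<longrightarrow> pd j = pd (j + 2 * l)) \<longleftrightarrow>
      (\<forall>j<i. i \<le> j + l \<longrightarrow> pd j = pd (j + l))" (is "?A \<longleftrightarrow> ?B")
    and odd: "(\<forall>j<Suc (2 * i). Suc (2 * i) \<le> j + 2 * l \<longrightarrow> pd j = pd (j + 2 * l)) \<longleftrightarrow>
      (\<forall>j<i. i \<le> j + l \<longrightarrow> pd j = pd (j + l))" (is "?C \<longleftrightarrow> ?B")
  proof -
    have step: "pd (Suc (2 * j)) = pd (Suc (2 * j) + 2 * l) \<longleftrightarrow> pd j = pd (j + l)" for j
    proof -
      have "Suc (2 * j) + 2 * l = Suc (2 * (j + l))" by simp
      then show ?thesis by (simp only: pd_odd) simp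
    qed
    have zero: "pd (2 * j) = pd (2 * j + 2 * l)" for j
      by (metis pd_even distrib_left)
    show "?A \<longleftrightarrow> ?B"
    proof
      assume A: ?A
      show ?B
      proof (intro allI impI)
        fix j assume "j < i" "i \<le> j + l"
        then show "pd j = pd (j + l)"
          using A[rule_format, of "Suc (2 * j)"] step by simp
      qed
    next
      assume B: ?B
      show ?A
      proof (intro allI impI)
        fix j assume j: "j < 2 * i" "2 * i \<le> j + 2 * l"
        show "pd j = pd (j + 2 * l)"
        proof (cases "even j")
          case True
          then show ?thesis using zero by (auto elim!: evenE)
        next
          case False
          then obtain m where "j = Suc (2 * m)" by (auto elim!: oddE)
          moreover from this j have "m < i" "i \<le> m + l" by auto
          ultimately show ?thesis using B step by metis
        qed
      qed
    qed
    show "?C \<longleftrightarrow> ?B"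
    proof
      assume C: ?C
      show ?B
      proof (intro allI impI)
        fix j assume "j < i" "i \<le> j + l"
        then show "pd j = pd (j + l)"
          using C[rule_format, of "Suc (2 * j)"] step by simp
      qed
    next
      assume B: ?B
      show ?C
      proof (intro allI impI)
        fix j assume j: "j < Suc (2 * i)" "Suc (2 * i) \<le> j + 2 * l"
        show "pd j = pd (j + 2 * l)"
        proof (cases "even j")
          case True
          then show ?thesis using zero by (auto elim!: evenE)
        next
          case False
          then obtain m where "j = Suc (2 * m)" by (auto elim!: oddE)
          moreover from this j have "m < i" "i \<le> m + l" by auto
          ultimately show ?thesis using B step by metis
        qed
      qed
    qed
  qed
  show ?even ?odd
    unfolding repetition_def even odd by simp_all
qed

text \<open>
  A position \<open>t \<equiv> 1 (mod 4)\<close> inside the repetition carries the letter \<open>1\<close>, while its partner at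
  odd distance \<open>l\<close> has even index and so carries \<open>0\<close>.
\<close>
lemma odd_repetition_pd:
  assumes rep: "repetition pd i l" and "odd l" and "2 \<le> i"
  shows "l = 1"
proof (rule ccontr)
  assume "l \<noteq> 1"
  with \<open>odd l\<close> have l: "3 \<le> l" by presburger
  have eq: "pd j = pd (j + l)" if "j < i" "i \<le> j + l" for j
    using rep that by (simp add: repetition_def)
  have pd0: "pd j = 0" if "even j" for j
    using that by (auto elim!: evenE)
  show False
  proof (cases "i \<le> l")
    case True
    then have "pd 1 = pd (1 + l)"
      using eq[of 1] \<open>2 \<le> i\<close> by simp
    then show False
      using pd_mod_4_eq_1[of 1] pd0[of "1 + l"] \<open>odd l\<close> by simp
  next
    case False
    define d where "d = i - l"
    \<comment> \<open>The least \<open>t \<ge> d\<close> with \<open>t \<equiv> 1\<close> (mod 4);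
      it falls within the window of length \<open>2 * l \<ge> 6\<close> starting at
      \<open>d\<close>.\<close>
    define t where "t = 4 * ((d + 2) div 4) + 1"
    have "d \<le> t" "t \<le> d + 3" and t1: "t mod 4 = 1"
      unfolding t_def by presburger+
    then have t: "i - l \<le> t" "t < i + l"
      using False l unfolding d_def by linarith+
    have "odd t" using t1 by presburger
    have pdt: "pd t = 1" using pd_mod_4_eq_1 t1 .
    show False
    proof (cases "t < i")
      case True
      then have "pd t = pd (t + l)" using eq[of t] t by simp
      then show False using pdt pd0[of "t + l"] \<open>odd t\<close> \<open>odd l\<close> by simp
    next
      case F: False
      then have "pd (t - l) = pd t" using eq[of "t - l"] t False by simp
      then show False
        using pdt pd0[of "t - l"] \<open>odd t\<close> \<open>odd l\<close> F False by simp
    qed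
  qed
qed

section \<open>Least periods under doubling of the position\<close>

definition pd_period :: "nat \<Rightarrow> nat" where
  "pd_period i = (LEAST l. repetition pd i l)"

text \<open>Halve the position and double the length; at \<open>0\<close> every positive length
  qualifies vacuously.\<close>

lemma repetition_pd_exists: "\<exists>l. repetition pd i l"
proof (induction i rule: less_induct)
  case (less i)
  show ?case
  proof (cases "i = 0")
    case True
    then show ?thesis by (auto simp: repetition_def)
  next
    case False
    then obtain l where l: "repetition pd (i div 2) l"
      using less[of "i div 2"] by auto
    have "i = 2 * (i div 2) \<or> i = Suc (2 * (i div 2))" by presburger
    then show ?thesis
      using l repetition_pd_double repetition_pd_double_Suc by metis
  qed
qed

lemma repetition_pd_period: "repetition pd i (pd_period i)"
  unfolding pd_period_def by (metis LeastI repetition_pd_exists)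

lemma pd_period_le: "repetition pd i l \<Longrightarrow> pd_period i \<le> l"
  unfolding pd_period_def by (rule Least_le)

lemma pd_period_pos: "0 < pd_period i"
  using repetition_pd_period by (simp add: repetition_def)

lemma periodicity_pd: "periodicity pd i = enat (pd_period i)"
  using periodicity_eq_Least[OF repetition_pd_period] by (simp add: pd_period_def)

lemma pd_period_0: "pd_period 0 = 1"
  using pd_period_le[of 0 1] pd_period_pos[of 0] by (simp add: repetition_def)

lemma pd_period_eq_1_iff: "pd_period (Suc i) = 1 \<longleftrightarrow> pd i = pd (Suc i)"
  using repetition_one[of pd i] repetition_pd_period[of "Suc i"] pd_period_le[of "Suc i" 1]
    pd_period_pos[of "Suc i"] by (auto simp: le_Suc_eq)

text \<open>By \<open>odd_repetition_pd\<close>, which requires \<open>2 \<le> i'\<close>, a least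
  period other than \<open>1\<close> is even, so it comes from position \<open>i\<close>. The
  abstract \<open>i'\<close> serves both \<open>2 * i\<close> and
  \<open>Suc (2 * i)\<close>.\<close>

lemma pd_period_eq_double:
  assumes double: "\<And>l. repetition pd i' (2 * l) \<longleftrightarrow> repetition pd i l"
    and ne: "pd_period i' \<noteq> 1" and "2 \<le> i'"
  shows "pd_period i' = 2 * pd_period i"
proof (rule antisym)
  show "pd_period i' \<le> 2 * pd_period i"
    using pd_period_le double repetition_pd_period by blast
  have "even (pd_period i')"
    using odd_repetition_pd[OF repetition_pd_period[of i']] ne \<open>2 \<le> i'\<close> by blast
  then obtain l where l: "pd_period i' = 2 * l" by (auto elim!: evenE)
  then show "2 * pd_period i \<le> pd_period i'"
    using pd_period_le double repetition_pd_period[of i'] by simp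
qed

lemma pd_period_1: "pd_period 1 = 2"
proof -
  have "pd 1 = 1" by (simp add: pd_mod_4_eq_1)
  then have "pd_period 1 \<noteq> 1"
    using pd_period_eq_1_iff[of 0] pd_0 by simp
  moreover have "pd_period 1 \<le> 2"
    using pd_period_le[of 1 2] repetition_pd_double_Suc[of 0 1] by (simp add: repetition_def)
  ultimately show ?thesis
    using pd_period_pos[of 1] by simp
qed

text \<open>Period \<open>1\<close> means that \<open>pd (Suc (2 * i)) = pd i + 1\<close> agrees
  with the next letter, a \<open>0\<close> at even index.\<close>

lemma pd_period_double:
  "pd_period (2 * Suc i) = (if pd i = 1 then 1 else 2 * pd_period (Suc i))"
proof -
  have "pd_period (2 * Suc i) = 1 \<longleftrightarrow> pd i = 1"
    using pd_period_eq_1_iff[of "Suc (2 * i)"] pd_even[of "Suc i"] pd_odd[of i]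
    by (cases "pd i") simp_all
  then show ?thesis
    using pd_period_eq_double[OF repetition_pd_double, of "Suc i"] by auto
qed

lemma pd_period_double_Suc:
  "pd_period (Suc (2 * i)) = (if pd i = 1 then 1 else 2 * pd_period i)"
proof (cases "i = 0")
  \<comment> \<open>Position \<open>1\<close> is out of reach of \<open>odd_repetition_pd\<close>,
    so its value is taken from \<open>pd_period_1\<close>.\<close>
  case True
  then show ?thesis using pd_period_0 pd_period_1 pd_0 by simp
next
  case False
  have "pd_period (Suc (2 * i)) = 1 \<longleftrightarrow> pd i = 1"
    using pd_period_eq_1_iff[of "2 * i"] by (cases "pd i") simp_all
  then show ?thesis
    using pd_period_eq_double[OF repetition_pd_double_Suc, of i] False by auto
qed

text \<open>For \<open>i = Suc m\<close>, the letters at \<open>m\<close> and \<open>i\<close> are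
  not both \<open>1\<close>. If they differ, exactly one period of the pair is \<open>1\<close> and
  the other is doubled; if both are \<open>0\<close>, then \<open>pd_period i = 1\<close> and both
  are doubled, giving 4.\<close>

lemma pd_period_pair:
  "pd_period (2 * i) + pd_period (Suc (2 * i)) =
     2 * pd_period i + 1 + of_bool (0 < i \<and> pd_period i = 1)"
proof (cases i)
  case 0
  then show ?thesis using pd_period_0 pd_period_1 by simp
next
  case (Suc m)
  have "pd m = 0 \<or> pd (Suc m) = 0"
    using pd_even by (metis evenE even_Suc)
  then show ?thesis
    unfolding Suc pd_period_double pd_period_double_Suc
    using pd_period_eq_1_iff[of m] by (cases "pd m"; cases "pd (Suc m)") auto
qed

text \<open>In the other two classes one of \<open>i - 1\<close>, \<open>i\<close> is
  \<open>1\<close> modulo 4 and carries \<open>1\<close>, while the other is even and carries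
  \<open>0\<close>.\<close>

lemma pd_period_eq_1_mod_4:
  assumes "0 < i" "pd_period i = 1"
  shows "i mod 4 = 0 \<or> i mod 4 = 3"
proof -
  obtain m where m: "i = Suc m" using assms(1) gr0_conv_Suc by auto
  have eq: "pd m = pd i" using assms(2) pd_period_eq_1_iff m by simp
  have "i mod 4 \<noteq> 1"
  proof
    assume i: "i mod 4 = 1"
    then have "even m" unfolding m by presburger
    then show False using eq pd_mod_4_eq_1[OF i] by (auto elim!: evenE)
  qed
  moreover have "i mod 4 \<noteq> 2"
  proof
    assume i: "i mod 4 = 2"
    then have "m mod 4 = 1" "even i" unfolding m by presburger+
    then show False using eq pd_mod_4_eq_1[of m] by (auto elim!: evenE)
  qed
  ultimately show ?thesis by presburger
qed

section \<open>Partial sums under doubling\<close>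

definition pd_sum :: "nat \<Rightarrow> nat" where
  "pd_sum n = (\<Sum>i<n. pd_period i)"

lemma sum_periodicity_pd: "sum_periodicity pd n = enat (pd_sum n)"
  unfolding sum_periodicity_def pd_sum_def periodicity_pd
  by (induction n) (simp_all add: zero_enat_def)

lemma pd_sum_Suc: "pd_sum (Suc n) = pd_sum n + pd_period n"
  by (simp add: pd_sum_def)

text \<open>Accumulates the correction term of \<open>pd_period_pair\<close>.\<close>

definition pd_count :: "nat \<Rightarrow> nat" where
  "pd_count n = (\<Sum>i<n. of_bool (0 < i \<and> pd_period i = 1))"

lemma pd_sum_double: "pd_sum (2 * n) = 2 * pd_sum n + n + pd_count n"
proof (induction n)
  case 0
  then show ?case by (simp add: pd_sum_def pd_count_def)
next
  case (Suc n)
  have "pd_sum (2 * Suc n) = pd_sum (2 * n) + (pd_period (2 * n) + pd_period (Suc (2 * n)))"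
    by (simp add: pd_sum_Suc)
  then show ?case
    unfolding pd_period_pair using Suc by (simp add: pd_sum_Suc pd_count_def)
qed

lemma pd_count_le: "2 * pd_count n \<le> n"
proof -
  \<comment> \<open>The quotients count the \<open>i < n\<close> with \<open>i \<equiv> 3\<close>
    and the positive \<open>i < n\<close> with \<open>i \<equiv> 0\<close> (mod 4).\<close>
  have "pd_count n \<le> n div 4 + (n - 1) div 4"
  proof (induction n)
    case 0
    then show ?case by (simp add: pd_count_def)
  next
    case (Suc n)
    have *: "pd_count (Suc n) = pd_count n + of_bool (0 < n \<and> pd_period n = 1)"
      by (simp add: pd_count_def)
    show ?case
    proof (cases "0 < n \<and> pd_period n = 1")
      case True
      then obtain m where m: "n = Suc m" using gr0_conv_Suc by auto
      have "Suc m mod 4 = 0 \<or> Suc m mod 4 = 3"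
        using True pd_period_eq_1_mod_4 m by blast
      then have "m div 4 + 1 \<le> Suc (Suc m) div 4"
        by presburger
      then have "n div 4 + (n - 1) div 4 + 1 \<le> Suc n div 4 + (Suc n - 1) div 4"
        by (simp add: m)
      then show ?thesis using * True Suc by simp
    next
      case False
      have "pd_count (Suc n) = pd_count n"
        unfolding * using False by simp
      moreover have "n div 4 + (n - 1) div 4 \<le> Suc n div 4 + (Suc n - 1) div 4"
        by (simp add: add_mono div_le_mono)
      ultimately show ?thesis using Suc by linarith
    qed
  qed
  then show ?thesis by linarith
qed

section \<open>Integer bounds on dyadic intervals\<close>

text \<open>The factor 18 clears the denominators of the claimed bound; doubling uses only
  \<open>pd_count m \<ge> 0\<close>.\<close>

lemma pd_sum_lower:
  assumes "2 ^ k \<le> n" "n \<le> 2 ^ Suc k"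
  shows "(6 * k + 5) * n + 8 \<le> 18 * pd_sum n"
  using assms
proof (induction k arbitrary: n)
  case 0
  then have "n = 1 \<or> n = 2" by auto
  then show ?case
    using pd_period_0 pd_period_1 by (auto simp: pd_sum_def numeral_2_eq_2)
next
  case (Suc k)
  define m where "m = n div 2"
  have m: "2 ^ k \<le> m" "m \<le> 2 ^ Suc k" using Suc.prems unfolding m_def by auto
  have IH: "(6 * k + 5) * m + 8 \<le> 18 * pd_sum m" using Suc.IH m .
  \<comment> \<open>For odd \<open>n\<close> the extra position adds \<open>6 * k + 11\<close> to
    the left side; the slack \<open>6 * m\<close> left by doubling absorbs its growth in
    \<open>k\<close>.\<close>
  have km: "k < m" using m(1) less_exp[of k] by linarith
  have double: "2 * pd_sum m + m \<le> pd_sum (2 * m)" by (simp add: pd_sum_double)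
  consider "n = 2 * m" | "n = Suc (2 * m)" unfolding m_def by linarith
  then show ?case
  proof cases
    case 1
    then show ?thesis using IH double km by (simp add: algebra_simps)
  next
    case 2
    have "2 * pd_sum m + m + 1 \<le> pd_sum n"
      using double pd_period_pos[of "2 * m"] 2 by (simp add: pd_sum_Suc)
    then show ?thesis using IH km 2 by (simp add: algebra_simps)
  qed
qed

text \<open>The factor 9 clears denominators. The closed right end keeps \<open>Suc m\<close> in
  range when \<open>n = Suc (2 * m)\<close>.\<close>

lemma pd_sum_upper:
  assumes "2 ^ k \<le> n" "n \<le> 2 ^ Suc k"
  shows "9 * pd_sum n \<le> (12 * k + 22) * n + 5"
  using assms
proof (induction k arbitrary: n)
  case 0
  then have "n = 1 \<or> n = 2" by auto
  then show ?case
    using pd_period_0 pd_period_1 by (auto simp: pd_sum_def numeral_2_eq_2)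
next
  case (Suc k)
  define m where "m = n div 2"
  have m: "2 ^ k \<le> m" "m \<le> 2 ^ Suc k" using Suc.prems unfolding m_def by auto
  have IH: "9 * pd_sum m \<le> (12 * k + 22) * m + 5" using Suc.IH m .
  have m0: "0 < m" using m(1) less_exp[of k] by linarith
  have double: "2 * pd_sum (2 * m) \<le> 4 * pd_sum m + 3 * m"
    using pd_count_le[of m] by (simp add: pd_sum_double)
  have even: "9 * pd_sum (2 * m) \<le> (12 * Suc k + 22) * (2 * m) + 5"
    using IH double m0 by (simp add: algebra_simps)
  consider "n = 2 * m" | "n = Suc (2 * m)" unfolding m_def by linarith
  then show ?case
  proof cases
    case 1
    then show ?thesis using even by simp
  next
    case 2
    have m': "2 ^ k \<le> Suc m" "Suc m \<le> 2 ^ Suc k"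
      using m Suc.prems 2 by auto
    obtain j where j: "m = Suc j" using m0 gr0_conv_Suc by auto
    consider "pd_period (2 * m) = 1" | "pd_period (2 * m) = 2 * pd_period m"
      using pd_period_double[of j] j by metis
    then show ?thesis
    proof cases
      case 1
      then show ?thesis using even 2 by (simp add: pd_sum_Suc)
    next
      case odd: 2
      \<comment> \<open>The last period \<open>2 * pd_period m\<close> turns
        \<open>2 * pd_sum m\<close> into \<open>2 * pd_sum (Suc m)\<close>, so induction is applied
        at \<open>Suc m\<close>.\<close>
      have IH': "9 * pd_sum (Suc m) \<le> (12 * k + 22) * Suc m + 5" using Suc.IH m' .
      have sum: "2 * pd_sum n \<le> 4 * pd_sum (Suc m) + 3 * m"
        using double odd 2 by (simp add: pd_sum_Suc)
      show ?thesis
      \<comment> \<open>Exactly the inequality to which \<open>IH'\<close> and \<open>sum\<close>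
        reduce the claim. Since \<open>2 ^ k \<le> m\<close>, it fails only for \<open>n = 3\<close>
        and \<open>n = 5\<close>.\<close>
      proof (cases "8 * k + 10 \<le> 7 * m")
        case True
        then show ?thesis using IH' sum 2 by (simp add: algebra_simps)
      next
        case False
        have "k < 2"
        proof (rule ccontr)
          assume "\<not> k < 2"
          then have "2 \<le> k" by simp
          then have "8 * k + 10 \<le> 7 * 2 ^ k"
            by (induction k rule: dec_induct) auto
          then show False using m(1) False by linarith
        qed
        then consider "k = 0" "m = 1" | "k = 1" "m = 2"
          using False m0 m by (cases k) auto
        then show ?thesis
        proof cases
          case 1
          have "pd_period 2 = 4"
            using pd_period_double[of 0] pd_period_1 pd_0 by (simp add: numeral_2_eq_2)
          then show ?thesis
            using 1 2 pd_period_0 pd_period_1 by (simp add: pd_sum_def eval_nat_numeral)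
        next
          case case2: 2
          have "pd_period 2 = 4"
            using pd_period_double[of 0] pd_period_1 pd_0 by (simp add: numeral_2_eq_2)
          then have "pd_sum (Suc 2) = 7"
            using pd_period_0 pd_period_1 by (simp add: pd_sum_def eval_nat_numeral)
          then show ?thesis
            using case2 2 sum by simp
        qed
      qed
    qed
  qed
qed

theorem theorem7:
  fixes n :: nat
  assumes "n \<ge> 1"
  shows "(ereal ((1/3 * log 2 (real n) - 1/18) * real n + 4/9)
             \<le> ereal_of_enat (sum_periodicity pd n) \<and>
          ereal_of_enat (sum_periodicity pd n)
             \<le> ereal ((4/3 * log 2 (real n) + 22/9) * real n + 5/9)) \<and>
         (ereal (1/3 * log 2 (real n) - 1/18) \<le> mean_periodicity pd n \<and>
          mean_periodicity pd n \<le> ereal (4/3 * log 2 (real n) + 3))"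
proof -
  obtain k where k: "2 ^ k \<le> n" "n < 2 ^ Suc k"
    using ex_power_ivl1[of 2 n] assms by auto
  have log: "real k \<le> log 2 (real n)" "log 2 (real n) \<le> real k + 1"
  proof -
    have "2 ^ k \<le> real n" "real n \<le> 2 ^ Suc k"
      using k by (metis of_nat_le_iff of_nat_numeral of_nat_power less_imp_le)+
    then show "real k \<le> log 2 (real n)" "log 2 (real n) \<le> real k + 1"
      using assms by (simp_all add: le_log_iff log_le_iff powr_realpow powr_add)
  qed
  have "real ((6 * k + 5) * n + 8) \<le> real (18 * pd_sum n)"
    using pd_sum_lower[of k n] k by (intro of_nat_mono) simp
  then have "(1/3 * (real k + 1) - 1/18) * real n + 4/9 \<le> real (pd_sum n)"
    by (simp add: field_simps)
  moreover have "(1/3 * log 2 (real n) - 1/18) * real n \<le> (1/3 * (real k + 1) - 1/18) * real n"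
    using log by (intro mult_right_mono) auto
  ultimately have lower: "(1/3 * log 2 (real n) - 1/18) * real n + 4/9 \<le> real (pd_sum n)"
    by linarith
  have "real (9 * pd_sum n) \<le> real ((12 * k + 22) * n + 5)"
    using pd_sum_upper[of k n] k by (intro of_nat_mono) simp
  then have "real (pd_sum n) \<le> (4/3 * real k + 22/9) * real n + 5/9"
    by (simp add: field_simps)
  moreover have "(4/3 * real k + 22/9) * real n \<le> (4/3 * log 2 (real n) + 22/9) * real n"
    using log by (intro mult_right_mono) auto
  ultimately have upper: "real (pd_sum n) \<le> (4/3 * log 2 (real n) + 22/9) * real n + 5/9"
    by linarith
  have "mean_periodicity pd n = ereal (real (pd_sum n) / real n)"
    using assms by (simp add: mean_periodicity_def sum_periodicity_pd)
  moreover have "1/3 * log 2 (real n) - 1/18 \<le> real (pd_sum n) / real n"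
    using lower assms by (subst pos_le_divide_eq) auto
  \<comment> \<open>As \<open>n \<ge> 1\<close>, the constant \<open>5/9\<close> is at most
    \<open>5/9 * n\<close>, and \<open>22/9 + 5/9 = 3\<close>.\<close>
  moreover have "real (pd_sum n) / real n \<le> 4/3 * log 2 (real n) + 3"
    using upper assms by (subst pos_divide_le_eq) (auto simp: algebra_simps)
  ultimately show ?thesis
    using lower upper by (simp add: sum_periodicity_pd)
qed

end
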